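(* If $b$ is a positive integer with $b\equiv 120 \pmod{330}$, then there exists a $v$-palindrome in base $b$.
   Context: Natural numbers are positive integers. Every natural number $n$ has a unique base $b$ representation ($b\ge 2$) $n=a_0+a_1b+\cdots+a_{L-1}b^{L-1}$ with $L\ge 1$, integers $0\le a_i<b$ and $a_{L-1}\ne 0$. The digit reversal of $n$ in base $b$ is $r_b(n)=a_{L-1}+a_{L-2}b+\cdots+a_0b^{L-1}$. The function $v$ on natural numbers: if $n=p_1^{\varepsilon_1}\cdots p_s^{\varepsilon_s}q_1\cdots q_t$ with $s,t\ge 0$, integers $\varepsilon_i\ge 2$ and distinct primes $p_1,\dots,p_s,q_1,\dots,q_t$, then $v(n)=\sum_{i=1}^s(p_i+\varepsilon_i)+\sum_{j=1}^t q_j$ (so $v(1)=0$). A natural number $n$ is a $v$-palindrome in base $b$ if (i) $b\nmid n$, (ii) $n\ne r_b(n)$, and (iii) $v(n)=v(r_b(n))$. *)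

theory Defs
  imports Main "HOL-Computational_Algebra.Primes" "HOL-Number_Theory.Cong"
begin

text \<open>Digit lists are least significant digit first, and the leading digit
  (the last list entry) is nonzero.\<close>

definition base_repr :: "nat \<Rightarrow> nat \<Rightarrow> nat list \<Rightarrow> bool" where
  "base_repr b n as \<longleftrightarrow>
     as \<noteq> [] \<and> (\<forall>a\<in>set as. a < b) \<and> last as \<noteq> 0 \<and> n = (\<Sum>i<length as. as ! i * b ^ i)"

lemma base_repr_ex1:
  assumes "b \<ge> 2" "n > 0"
  shows "\<exists>!as. base_repr b n as"
  using assms(2)
proof (induction n rule: less_induct)
  case (less n)
  have cons: "(\<Sum>i<length (a # as). (a # as) ! i * b ^ i) = a + b * (\<Sum>i<length as. as ! i * b ^ i)"
    for a as
    by (simp only: length_Cons sum.lessThan_Suc_shift sum_distrib_left) (simp add: ac_simps)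
  have tail: "base_repr b m as \<Longrightarrow> m > 0" for m as
  proof -
    assume r: "base_repr b m as"
    let ?i = "length as - 1"
    have i: "?i < length as" "as ! ?i \<noteq> 0"
      using r by (auto simp: base_repr_def last_conv_nth)
    have "0 < as ! ?i * b ^ ?i" using i assms(1) by simp
    also have "\<dots> \<le> (\<Sum>i<length as. as ! i * b ^ i)"
      by (rule member_le_sum) (use i in auto)
    finally show "m > 0" using r by (simp add: base_repr_def)
  qed
  have split: "base_repr b n as \<longleftrightarrow>
      (if n < b then as = [n] else \<exists>as'. as = n mod b # as' \<and> base_repr b (n div b) as')" for as
  proof (cases as)
    case Nil
    then show ?thesis by (simp add: base_repr_def)
  next
    case (Cons a as')
    show ?thesis
    proof (cases "as' = []")
      case True
      then show ?thesis using Cons less.prems by (auto simp: base_repr_def)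
    next
      case False
      have dm: "a < b \<Longrightarrow> n = a + b * s \<longleftrightarrow> a = n mod b \<and> s = n div b" for s
        using assms(1) by auto
      have eq: "base_repr b n as \<longleftrightarrow> a = n mod b \<and> base_repr b (n div b) as'"
        unfolding base_repr_def Cons cons using False dm assms(1) by auto
      show ?thesis
      proof (cases "n < b")
        case True
        then have "\<not> base_repr b (n div b) as'" using tail[of "n div b" as'] by auto
        then show ?thesis using True eq Cons False by auto
      next
        case nb: False
        then show ?thesis using eq Cons by auto
      qed
    qed
  qed
  show ?case
  proof (cases "n < b")
    case True
    then show ?thesis by (simp add: split)
  next
    case False
    then have "n div b < n" "n div b > 0"
      using assms(1) less.prems by (auto simp: div_greater_zero_iff)
    from less.IH[OF this] show ?thesis using False by (auto simp: split)
  qed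
qed

definition base_digits :: "nat \<Rightarrow> nat \<Rightarrow> nat list" where
  "base_digits b n = (THE as. base_repr b n as)"

definition digit_reversal :: "nat \<Rightarrow> nat \<Rightarrow> nat" where
  "digit_reversal b n =
     (let as = base_digits b n; L = length as in \<Sum>i<L. as ! (L - 1 - i) * b ^ i)"

definition vfun :: "nat \<Rightarrow> nat" where
  "vfun n = (\<Sum>p | p \<in> prime_factors n \<and> multiplicity p n \<ge> 2. p + multiplicity p n)
       + (\<Sum>q | q \<in> prime_factors n \<and> multiplicity q n = 1. q)"

text \<open>The base is meant to satisfy \<open>b \<ge> 2\<close>, and natural numbers are positive.\<close>

definition v_palindrome :: "nat \<Rightarrow> nat \<Rightarrow> bool" where
  "v_palindrome b n \<longleftrightarrow>
     n > 0 \<and> \<not> b dvd n \<and> n \<noteq> digit_reversal b n \<and> vfun n = vfun (digit_reversal b n)"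

end

theory Submission
  imports Defs
begin

text \<open>Two facts combine. If \<open>x + y = b + 1\<close>, then \<open>x (b - 1)\<close> has the two base-\<open>b\<close> digits
  \<open>x - 1\<close> (leading) and \<open>b - x = y - 1\<close>, so reversing its digits exchanges \<open>x\<close> and \<open>y\<close>
  (lemma \<open>digit_reversal_mult_pred_base\<close>; in base ten, \<open>18 = 2 \<sqdot> 9\<close> and \<open>81 = 9 \<sqdot> 9\<close>).
  And \<open>v\<close> is additive on coprime factors (lemma \<open>vfun_mult_coprime\<close>), so
  \<open>v(5 k) = 5 + v(k) = (2 + 3) + v(k) = v(6 k)\<close> for every \<open>k\<close> coprime to 30
  (lemma \<open>vfun_mult_5_eq_mult_6\<close>).

  The congruence \<open>b \<equiv> 120 (mod 330)\<close> says exactly that 11 divides \<open>b + 1\<close> and 30 divides \<open>b\<close>.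
  With \<open>b + 1 = 11 m\<close>, the choice \<open>x = 5 m\<close>, \<open>y = 6 m\<close> is available since \<open>5 + 6 = 11\<close>,
  and the common cofactor \<open>k = m (b - 1)\<close> is coprime to 30 because it divides
  \<open>(b + 1) (b - 1)\<close>, both of whose factors are coprime to \<open>b\<close>. Hence \<open>5 m (b - 1)\<close> is a
  \<open>v\<close>-palindrome.\<close>

lemma digit_reversal_two_digits:
  assumes "a < b" "c < b" "c \<noteq> 0"
  shows "digit_reversal b (a + c * b) = c + a * b"
proof -
  have "b \<ge> 2" "a + c * b > 0" using assms by auto
  moreover have "base_repr b (a + c * b) [a, c]"
    using assms by (simp add: base_repr_def)
  ultimately have "base_digits b (a + c * b) = [a, c]"
    unfolding base_digits_def by (intro the1_equality base_repr_ex1)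
  then show ?thesis by (simp add: digit_reversal_def numeral_2_eq_2)
qed

lemma mult_pred_base_digits:
  fixes x y b :: nat
  assumes "x + y = b + 1" "x \<ge> 1" "y \<ge> 1"
  shows "x * (b - 1) = (y - 1) + (x - 1) * b"
proof -
  obtain x' y' where "x = Suc x'" "y = Suc y'"
    using assms(2,3) by (metis Suc_le_D One_nat_def)
  moreover from this have "b = Suc (x' + y')" using assms(1) by simp
  ultimately show ?thesis by (simp add: algebra_simps)
qed

text \<open>The digits \<open>y - 1\<close>, \<open>x - 1\<close> depend symmetrically on \<open>x\<close> and \<open>y\<close>; the bound \<open>x \<ge> 2\<close>
  makes the leading digit nonzero.\<close>

lemma digit_reversal_mult_pred_base:
  assumes "x + y = b + 1" "x \<ge> 2" "y \<ge> 1"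
  shows "digit_reversal b (x * (b - 1)) = y * (b - 1)"
proof -
  have "digit_reversal b (x * (b - 1)) = digit_reversal b ((y - 1) + (x - 1) * b)"
    using assms by (subst mult_pred_base_digits[of x y b]) auto
  also have "\<dots> = (x - 1) + (y - 1) * b"
    using assms by (intro digit_reversal_two_digits) auto
  also have "\<dots> = y * (b - 1)"
    using assms by (subst mult_pred_base_digits[of y x b]) auto
  finally show ?thesis .
qed

text \<open>Both sums in the definition of \<open>v\<close> merge into one sum of local contributions, each
  depending only on a prime and its exponent; additivity can then be read off.\<close>

lemma vfun_eq_sum:
  "vfun n = (\<Sum>p\<in>prime_factors n. if multiplicity p n \<ge> 2 then p + multiplicity p n else p)"
proof -
  have *: "{p \<in> prime_factors n. multiplicity p n = 1}
      = {p \<in> prime_factors n. \<not> multiplicity p n \<ge> 2}"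
    by (auto simp: prime_factors_multiplicity)
  show ?thesis
    unfolding vfun_def * by (subst sum.If_cases) (auto simp: Int_def)
qed

lemma vfun_mult_coprime:
  assumes "coprime m n" "m > 0" "n > 0"
  shows "vfun (m * n) = vfun m + vfun n"
proof -
  have disj: "prime_factors m \<inter> prime_factors n = {}"
    using assms by (auto simp: prime_factors_dvd dest: coprime_common_divisor)
  have mult: "multiplicity p (m * n) = multiplicity p m + multiplicity p n"
    if "prime p" for p
    using assms that by (intro prime_elem_multiplicity_mult_distrib) auto
  have m: "multiplicity p (m * n) = multiplicity p m" if "p \<in> prime_factors m" for p
    using disj that mult[of p] by (auto simp: prime_factors_multiplicity)
  have n: "multiplicity p (m * n) = multiplicity p n" if "p \<in> prime_factors n" for p
    using disj that mult[of p] by (auto simp: prime_factors_multiplicity)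
  have "prime_factors (m * n) = prime_factors m \<union> prime_factors n"
    using assms by (simp add: prime_factors_product)
  then show ?thesis
    unfolding vfun_eq_sum using disj by (simp add: sum.union_disjoint m n cong: if_cong)
qed

lemma vfun_prime: "prime p \<Longrightarrow> vfun p = p"
  by (simp add: vfun_eq_sum prime_prime_factors)

lemma vfun_mult_5_eq_mult_6:
  assumes "coprime k 30" "k > 0"
  shows "vfun (5 * k) = vfun (6 * k)"
proof -
  have "30 = 5 * (6::nat)" by simp
  with assms(1) have "coprime 5 k" "coprime 6 k"
    by (metis coprime_mult_right_iff coprime_commute)+
  then have "vfun (5 * k) = vfun 5 + vfun k" "vfun (6 * k) = vfun 6 + vfun k"
    using assms(2) by (simp_all add: vfun_mult_coprime)
  moreover have "vfun 6 = 5"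
    using vfun_mult_coprime[of 2 3] by (simp add: vfun_prime coprime_Suc_right_nat)
  ultimately show ?thesis by (simp add: vfun_prime)
qed

theorem corollary22:
  fixes b :: nat
  assumes "b > 0" and "[b = 120] (mod 330)"
  shows "\<exists>n. v_palindrome b n"
proof -
  have "[b = 120] (mod 11)" "[b = 120] (mod 30)"
    by (rule cong_dvd_modulus_nat[OF assms(2)]; simp)+
  then have "b mod 11 = 10" and b30: "30 dvd b"
    by (simp_all add: cong_def mod_eq_0_iff_dvd)
  then have "11 dvd b + 1" by (simp add: dvd_eq_mod_eq_0 mod_Suc)
  then obtain m where m: "b + 1 = 11 * m" by auto
  have "m > 0" "b > 1" using m assms(1) by (cases m; simp)+
  define k where "k = m * (b - 1)"
  have "coprime b (b + 1)" "coprime b (b - 1)"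
    using assms(1) coprime_diff_one_left_nat[of b] by (simp_all add: coprime_commute)
  then have "coprime b k"
    unfolding m k_def by simp
  then have "coprime k 30"
    using b30 by (metis coprime_commute coprime_divisors dvd_refl)
  moreover have "k > 0" using \<open>m > 0\<close> \<open>b > 1\<close> by (simp add: k_def)
  ultimately have v: "vfun (5 * k) = vfun (6 * k)" by (rule vfun_mult_5_eq_mult_6)
  have "digit_reversal b (5 * m * (b - 1)) = 6 * m * (b - 1)"
    using m \<open>m > 0\<close> by (intro digit_reversal_mult_pred_base; linarith)
  then have rev: "digit_reversal b (5 * k) = 6 * k" by (simp add: k_def mult.assoc)
  \<comment> \<open>The last digit \<open>6 m - 1\<close> of \<open>5 k\<close> is nonzero.\<close>
  have "5 * k = (6 * m - 1) + (5 * m - 1) * b"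
    using mult_pred_base_digits[of "5 * m" "6 * m" b] m \<open>m > 0\<close> by (simp add: k_def mult.assoc)
  moreover have "0 < 6 * m - 1" "6 * m - 1 < b" using m \<open>m > 0\<close> by linarith+
  ultimately have "\<not> b dvd 5 * k"
    by (metis dvd_add_left_iff dvd_triv_right nat_dvd_not_less)
  then have "v_palindrome b (5 * k)"
    using \<open>k > 0\<close> rev v by (simp add: v_palindrome_def)
  then show ?thesis ..
qed

end
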